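(* Let $\tilde{\mathfrak g}$ be a solvable Lie algebra with a Sasaki pseudo-Riemannian metric $g$ (that is, $g$ is part of a Sasaki structure $(\phi,\xi,\eta,g)$ on $\tilde{\mathfrak g}$). Then there is no pseudo-Iwasawa decomposition of $(\tilde{\mathfrak g},g)$.
   Context: All structures are left-invariant and are described on a real finite-dimensional Lie algebra; a (pseudo-Riemannian) metric on a Lie algebra is a nondegenerate symmetric bilinear form of arbitrary signature. $d$ is the Chevalley–Eilenberg differential, $d\alpha(x,y)=-\alpha([x,y])$ for a $1$-form $\alpha$; $x^\flat=g(x,\cdot)$. An almost contact metric structure on a Lie algebra of dimension $2n+1$ is a quadruple $(\phi,\xi,\eta,g)$ with $\phi$ an endomorphism, $\xi$ a vector, $\eta$ a $1$-form and $g$ a metric such that $\eta(\xi)=1$, $\eta\circ\phi=0$, $\phi^2=-\mathrm{Id}+\eta\otimes\xi$, $g(\xi,\xi)=1$, $\eta=\xi^\flat$, $g(\phi x,\phi y)=g(x,y)-\eta(x)\eta(y)$. Its fundamental form is $\Phi=g(\cdot,\phi\,\cdot)$. It is Sasaki if $d\eta=2\Phi$ and $N_\phi+d\eta\otimes\xi=0$, where $N_\phi(x,y)=\phi^2[x,y]+[\phi x,\phi y]-\phi[\phi x,y]-\phi[x,\phi y]$. A standard decomposition of a metric Lie algebra $\tilde{\mathfrak g}$ is an orthogonal decomposition $\tilde{\mathfrak g}=\mathfrak g\rtimes\mathfrak a$ with $\mathfrak g$ a nilpotent ideal and $\mathfrak a$ an abelian subalgebra. It is pseudo-Iwasawa if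 $\mathrm{ad}\,X\colon\tilde{\mathfrak g}\to\tilde{\mathfrak g}$ is symmetric with respect to the metric for all $X\in\mathfrak a$.
   Formalization: The abelian factor of the decomposition is required to be nonzero and the dimension at least 3: otherwise the Heisenberg Sasaki algebra (with zero abelian factor) and the one-dimensional Sasaki algebra are counterexamples. *)

theory Defs
  imports "HOL-Analysis.Analysis"
begin

text \<open>
  The Lie algebra is the whole of a real vector space type \<open>'a\<close>, with bracket \<open>br\<close>. The class
  \<open>real_vector\<close> carries no preferred inner product, topology or basis.
\<close>

definition lie_algebra :: "('a::real_vector \<Rightarrow> 'a \<Rightarrow> 'a) \<Rightarrow> bool" where
  "lie_algebra br \<longleftrightarrow>
     (\<exists>B::'a set. finite B \<and> span B = UNIV) \<and>
     bilinear br \<and>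
     (\<forall>x. br x x = 0) \<and>
     (\<forall>x y z. br x (br y z) + br y (br z x) + br z (br x y) = 0)"

definition bracket_span :: "('a::real_vector \<Rightarrow> 'a \<Rightarrow> 'a) \<Rightarrow> 'a set \<Rightarrow> 'a set \<Rightarrow> 'a set" where
  "bracket_span br S T = span {br x y | x y. x \<in> S \<and> y \<in> T}"

definition lie_subalgebra :: "('a::real_vector \<Rightarrow> 'a \<Rightarrow> 'a) \<Rightarrow> 'a set \<Rightarrow> bool" where
  "lie_subalgebra br S \<longleftrightarrow> subspace S \<and> (\<forall>x\<in>S. \<forall>y\<in>S. br x y \<in> S)"

definition lie_ideal :: "('a::real_vector \<Rightarrow> 'a \<Rightarrow> 'a) \<Rightarrow> 'a set \<Rightarrow> bool" where
  "lie_ideal br S \<longleftrightarrow> subspace S \<and> (\<forall>x. \<forall>y\<in>S. br x y \<in> S)"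

definition lie_abelian :: "('a::real_vector \<Rightarrow> 'a \<Rightarrow> 'a) \<Rightarrow> 'a set \<Rightarrow> bool" where
  "lie_abelian br S \<longleftrightarrow> (\<forall>x\<in>S. \<forall>y\<in>S. br x y = 0)"

primrec derived_series :: "('a::real_vector \<Rightarrow> 'a \<Rightarrow> 'a) \<Rightarrow> 'a set \<Rightarrow> nat \<Rightarrow> 'a set" where
  "derived_series br S 0 = S"
| "derived_series br S (Suc k) = bracket_span br (derived_series br S k) (derived_series br S k)"

primrec lower_central_series :: "('a::real_vector \<Rightarrow> 'a \<Rightarrow> 'a) \<Rightarrow> 'a set \<Rightarrow> nat \<Rightarrow> 'a set" where
  "lower_central_series br S 0 = S"
| "lower_central_series br S (Suc k) = bracket_span br S (lower_central_series br S k)"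

definition lie_solvable :: "('a::real_vector \<Rightarrow> 'a \<Rightarrow> 'a) \<Rightarrow> 'a set \<Rightarrow> bool" where
  "lie_solvable br S \<longleftrightarrow> (\<exists>k. derived_series br S k = {0})"

definition lie_nilpotent :: "('a::real_vector \<Rightarrow> 'a \<Rightarrow> 'a) \<Rightarrow> 'a set \<Rightarrow> bool" where
  "lie_nilpotent br S \<longleftrightarrow> (\<exists>k. lower_central_series br S k = {0})"

text \<open>A pseudo-Riemannian metric, of arbitrary signature.\<close>

definition pseudo_metric :: "('a::real_vector \<Rightarrow> 'a \<Rightarrow> real) \<Rightarrow> bool" where
  "pseudo_metric g \<longleftrightarrow>
     bilinear g \<and> (\<forall>x y. g x y = g y x) \<and> (\<forall>x. (\<forall>y. g x y = 0) \<longrightarrow> x = 0)"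

text \<open>The Chevalley--Eilenberg differential of a 1-form.\<close>

definition ce_diff :: "('a::real_vector \<Rightarrow> 'a \<Rightarrow> 'a) \<Rightarrow> ('a \<Rightarrow> real) \<Rightarrow> 'a \<Rightarrow> 'a \<Rightarrow> real" where
  "ce_diff br \<alpha> x y = - \<alpha> (br x y)"

definition almost_contact_metric ::
  "nat \<Rightarrow> ('a::real_vector \<Rightarrow> 'a) \<Rightarrow> 'a \<Rightarrow> ('a \<Rightarrow> real) \<Rightarrow> ('a \<Rightarrow> 'a \<Rightarrow> real) \<Rightarrow> bool" where
  "almost_contact_metric n \<phi> \<xi> \<eta> g \<longleftrightarrow>
     dim (UNIV :: 'a set) = 2 * n + 1 \<and>
     linear \<phi> \<and> linear \<eta> \<and> pseudo_metric g \<and>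
     \<eta> \<xi> = 1 \<and>
     (\<forall>x. \<eta> (\<phi> x) = 0) \<and>
     (\<forall>x. \<phi> (\<phi> x) = - x + \<eta> x *\<^sub>R \<xi>) \<and>
     g \<xi> \<xi> = 1 \<and>
     (\<forall>x. \<eta> x = g \<xi> x) \<and>
     (\<forall>x y. g (\<phi> x) (\<phi> y) = g x y - \<eta> x * \<eta> y)"

definition fundamental_form ::
  "('a::real_vector \<Rightarrow> 'a) \<Rightarrow> ('a \<Rightarrow> 'a \<Rightarrow> real) \<Rightarrow> 'a \<Rightarrow> 'a \<Rightarrow> real" where
  "fundamental_form \<phi> g x y = g x (\<phi> y)"

definition nijenhuis ::
  "('a::real_vector \<Rightarrow> 'a \<Rightarrow> 'a) \<Rightarrow> ('a \<Rightarrow> 'a) \<Rightarrow> 'a \<Rightarrow> 'a \<Rightarrow> 'a" where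
  "nijenhuis br \<phi> x y =
     \<phi> (\<phi> (br x y)) + br (\<phi> x) (\<phi> y) - \<phi> (br (\<phi> x) y) - \<phi> (br x (\<phi> y))"

definition sasaki ::
  "nat \<Rightarrow> ('a::real_vector \<Rightarrow> 'a \<Rightarrow> 'a) \<Rightarrow> ('a \<Rightarrow> 'a) \<Rightarrow> 'a \<Rightarrow> ('a \<Rightarrow> real) \<Rightarrow>
     ('a \<Rightarrow> 'a \<Rightarrow> real) \<Rightarrow> bool" where
  "sasaki n br \<phi> \<xi> \<eta> g \<longleftrightarrow>
     almost_contact_metric n \<phi> \<xi> \<eta> g \<and>
     (\<forall>x y. ce_diff br \<eta> x y = 2 * fundamental_form \<phi> g x y) \<and>
     (\<forall>x y. nijenhuis br \<phi> x y + ce_diff br \<eta> x y *\<^sub>R \<xi> = 0)"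

text \<open>
  The semidirect product splitting \<open>\<gg> \<rtimes> \<aa>\<close> is internal: \<open>\<gg>\<close> and \<open>\<aa>\<close> are complementary
  subspaces, either of which may be zero here.
\<close>

definition standard_decomposition ::
  "('a::real_vector \<Rightarrow> 'a \<Rightarrow> 'a) \<Rightarrow> ('a \<Rightarrow> 'a \<Rightarrow> real) \<Rightarrow> 'a set \<Rightarrow> 'a set \<Rightarrow> bool" where
  "standard_decomposition br g \<gg> \<aa> \<longleftrightarrow>
     lie_ideal br \<gg> \<and> lie_nilpotent br \<gg> \<and>
     lie_subalgebra br \<aa> \<and> lie_abelian br \<aa> \<and>
     \<gg> \<inter> \<aa> = {0} \<and> {u + v | u v. u \<in> \<gg> \<and> v \<in> \<aa>} = UNIV \<and>
     (\<forall>u\<in>\<gg>. \<forall>v\<in>\<aa>. g u v = 0)"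

definition pseudo_iwasawa ::
  "('a::real_vector \<Rightarrow> 'a \<Rightarrow> 'a) \<Rightarrow> ('a \<Rightarrow> 'a \<Rightarrow> real) \<Rightarrow> 'a set \<Rightarrow> 'a set \<Rightarrow> bool" where
  "pseudo_iwasawa br g \<gg> \<aa> \<longleftrightarrow>
     standard_decomposition br g \<gg> \<aa> \<and>
     (\<forall>X\<in>\<aa>. \<forall>y z. g (br X y) z = g y (br X z))"

end

theory Submission
  imports Defs
begin

text \<open>
  Two symmetry properties of the Reeb vector \<open>\<xi>\<close> collide. The operator \<open>ad \<xi>\<close> is always
  skew-symmetric on a Sasaki Lie algebra (\<open>reeb_killing\<close>), while \<open>ad H\<close> is symmetric for \<open>H\<close> in
  \<open>\<aa>\<close>. Feeding the symmetry into \<open>d\<eta> = 2\<Phi>\<close> gives \<open>[H, \<xi>] = 2 \<phi> H\<close> (\<open>bracket_reeb_of_symmetric_ad\<close>).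
  On the other hand all brackets lie in \<open>\<gg>\<close>, hence are orthogonal to \<open>H\<close>, and skew-symmetry of
  \<open>ad \<xi>\<close> then gives \<open>g([\<xi>, H], x) = - g(H, [\<xi>, x]) = 0\<close> for every \<open>x\<close>. So \<open>\<phi> H = 0\<close>, which
  forces \<open>H\<close> to be a multiple of \<open>\<xi>\<close>. If \<open>\<aa>\<close> is nonzero it therefore contains \<open>\<xi>\<close>; all brackets
  are then orthogonal to \<open>\<xi>\<close>, so \<open>d\<eta> = 0\<close>, contradicting the contact condition in dimension at
  least three (\<open>reeb_not_orthogonal_to_brackets\<close>).
\<close>

lemma lie_bracket_skew:
  assumes "lie_algebra br"
  shows "br x y = - br y x"
proof -
  have bl: "bilinear br" and alt: "\<And>z. br z z = 0"
    using assms by (auto simp: lie_algebra_def)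
  have "br (x + y) (x + y) = (br x x + br y y) + (br x y + br y x)"
    by (simp add: bilinear_ladd[OF bl] bilinear_radd[OF bl])
  then have "br x y + br y x = 0"
    by (simp only: alt) simp
  then show ?thesis
    by (simp only: eq_neg_iff_add_eq_0)
qed

lemma standard_decomposition_bracket_in_ideal:
  assumes "lie_algebra br" and "standard_decomposition br g \<gg> \<aa>"
  shows "br x y \<in> \<gg>"
proof -
  have bl: "bilinear br" using assms(1) by (simp add: lie_algebra_def)
  have sub: "subspace \<gg>" and ideal: "\<And>x y. y \<in> \<gg> \<Longrightarrow> br x y \<in> \<gg>"
    and ab: "\<And>x y. x \<in> \<aa> \<Longrightarrow> y \<in> \<aa> \<Longrightarrow> br x y = 0"
    and sum: "{u + v | u v. u \<in> \<gg> \<and> v \<in> \<aa>} = UNIV"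
    using assms(2) by (auto simp: standard_decomposition_def lie_ideal_def lie_abelian_def)
  obtain u v where x: "x = u + v" "u \<in> \<gg>" "v \<in> \<aa>" using sum by blast
  obtain u' v' where y: "y = u' + v'" "u' \<in> \<gg>" "v' \<in> \<aa>" using sum by blast
  have "br x y = br x u' + (- br v' u + br v v')"
    using lie_bracket_skew[OF assms(1), of u v']
    by (simp add: x(1) y(1) bilinear_ladd[OF bl] bilinear_radd[OF bl])
  also have "\<dots> \<in> \<gg>"
    using ideal[OF x(2)] ideal[OF y(2)] ab[OF x(3) y(3)]
    by (simp only: subspace_add[OF sub] subspace_neg[OF sub] subspace_0[OF sub])
  finally show ?thesis .
qed

lemma standard_decomposition_bracket_orthogonal:
  assumes "lie_algebra br" and "standard_decomposition br g \<gg> \<aa>" and "v \<in> \<aa>"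
  shows "g (br x y) v = 0"
proof -
  have "\<forall>u\<in>\<gg>. \<forall>v\<in>\<aa>. g u v = 0"
    using assms(2) by (simp add: standard_decomposition_def)
  then show ?thesis
    using standard_decomposition_bracket_in_ideal[OF assms(1,2)] assms(3) by blast
qed

locale sasaki_lie_algebra =
  fixes br :: "'a::real_vector \<Rightarrow> 'a \<Rightarrow> 'a" and \<phi> \<xi> \<eta> g and n :: nat
  assumes lie: "lie_algebra br" and sasaki: "sasaki n br \<phi> \<xi> \<eta> g"
begin

lemma bilinear_br: "bilinear br"
  using lie by (simp add: lie_algebra_def)

lemma jacobi: "br x (br y z) + br y (br z x) + br z (br x y) = 0"
  using lie by (simp add: lie_algebra_def)

lemma
  shows dim_eq: "dim (UNIV :: 'a set) = 2 * n + 1"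
    and linear_phi: "linear \<phi>" and linear_eta: "linear \<eta>"
    and bilinear_g: "bilinear g"
    and g_sym: "g x y = g y x"
    and g_nondegenerate: "(\<And>y. g x y = 0) \<Longrightarrow> x = 0"
    and eta_phi: "\<eta> (\<phi> x) = 0"
    and phi_phi: "\<phi> (\<phi> x) = - x + \<eta> x *\<^sub>R \<xi>"
    and eta_xi: "\<eta> \<xi> = 1"
    and eta_eq: "\<eta> x = g \<xi> x"
    and g_phi_phi: "g (\<phi> x) (\<phi> y) = g x y - \<eta> x * \<eta> y"
  using sasaki by (auto simp: sasaki_def almost_contact_metric_def pseudo_metric_def)

lemma eta_bracket: "\<eta> (br x y) = - 2 * g x (\<phi> y)"
proof -
  have "ce_diff br \<eta> x y = 2 * fundamental_form \<phi> g x y"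
    using sasaki by (simp add: sasaki_def)
  then show ?thesis by (simp add: ce_diff_def fundamental_form_def)
qed

lemma nijenhuis_eq: "nijenhuis br \<phi> x y = \<eta> (br x y) *\<^sub>R \<xi>"
proof -
  have "nijenhuis br \<phi> x y + ce_diff br \<eta> x y *\<^sub>R \<xi> = 0"
    using sasaki unfolding sasaki_def by blast
  then show ?thesis by (simp add: ce_diff_def)
qed

lemma phi_xi: "\<phi> \<xi> = 0"
proof -
  have "\<phi> (\<phi> (\<phi> \<xi>)) = \<phi> 0" by (simp only: phi_phi[of \<xi>] eta_xi) simp
  then show ?thesis
    by (simp add: phi_phi[of "\<phi> \<xi>"] eta_phi linear_0[OF linear_phi])
qed

lemma phi_skew: "g (\<phi> x) y = - g x (\<phi> y)"
proof -
  have "g x (\<phi> y) = g (\<phi> x) (\<phi> (\<phi> y))" by (simp add: g_phi_phi eta_phi)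
  also have "\<dots> = - g (\<phi> x) y + \<eta> y * g (\<phi> x) \<xi>"
    by (simp only: phi_phi bilinear_radd[OF bilinear_g] bilinear_rneg[OF bilinear_g]
        bilinear_rmul[OF bilinear_g] real_scaleR_def)
  also have "g (\<phi> x) \<xi> = 0" using eta_phi eta_eq g_sym by metis
  finally show ?thesis by simp
qed

lemma eta_bracket_xi: "\<eta> (br \<xi> x) = 0"
  using eta_bracket eta_eq eta_phi by simp

text \<open>
  This is the normality condition evaluated at \<open>\<xi>\<close>: it becomes \<open>\<phi>\<^sup>2[\<xi>, x] = \<phi>[\<xi>, \<phi> x]\<close>, and
  \<open>\<phi>\<close> is injective on \<open>ker \<eta>\<close>, where both brackets live.
\<close>

lemma ad_xi_commutes_phi: "br \<xi> (\<phi> x) = \<phi> (br \<xi> x)"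
proof -
  have "\<phi> (\<phi> (br \<xi> x)) = \<phi> (br \<xi> (\<phi> x))"
    using nijenhuis_eq[of \<xi> x]
    by (simp add: nijenhuis_def phi_xi eta_bracket_xi bilinear_lzero[OF bilinear_br]
        linear_0[OF linear_phi])
  then have "\<phi> (\<phi> (\<phi> (br \<xi> x))) = \<phi> (\<phi> (br \<xi> (\<phi> x)))" by simp
  then show ?thesis
    by (simp add: phi_phi eta_phi eta_bracket_xi linear_neg[OF linear_phi])
qed

text \<open>
  The left-invariant field \<open>\<xi>\<close> is Killing. By the Jacobi identity \<open>ad \<xi>\<close> preserves \<open>d\<eta> = 2\<Phi>\<close>,
  and it commutes with \<open>\<phi>\<close>, so it preserves \<open>g\<close> against vectors in the image of \<open>\<phi>\<close>; a
  complement of that image is spanned by \<open>\<xi>\<close>, which is orthogonal to the image of \<open>ad \<xi>\<close>.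
\<close>

lemma reeb_killing: "g (br \<xi> x) y = - g x (br \<xi> y)"
proof -
  have on_image: "g (br \<xi> x) (\<phi> z) = - g x (br \<xi> (\<phi> z))" for z
  proof -
    have "\<eta> (br (br \<xi> x) z) + \<eta> (br x (br \<xi> z)) = \<eta> (br \<xi> (br x z))"
    proof -
      have "br (br \<xi> x) z + br x (br \<xi> z) = br \<xi> (br x z)"
        using jacobi[of \<xi> x z] lie_bracket_skew[OF lie, of "br \<xi> x" z]
          lie_bracket_skew[OF lie, of z \<xi>]
        by (simp add: bilinear_rneg[OF bilinear_br] algebra_simps)
      then show ?thesis by (metis linear_add[OF linear_eta])
    qed
    then have "g (br \<xi> x) (\<phi> z) + g x (\<phi> (br \<xi> z)) = 0"
      by (simp only: eta_bracket_xi eta_bracket[of "br \<xi> x"] eta_bracket[of x])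
    then show ?thesis by (simp add: ad_xi_commutes_phi)
  qed
  have y: "y = \<phi> (- \<phi> y) + \<eta> y *\<^sub>R \<xi>"
    by (simp add: linear_neg[OF linear_phi] phi_phi)
  have "g (br \<xi> x) \<xi> = 0" using eta_bracket_xi eta_eq g_sym by metis
  moreover have "br \<xi> \<xi> = 0" using lie by (simp add: lie_algebra_def)
  ultimately have "g (br \<xi> x) (\<phi> (- \<phi> y) + \<eta> y *\<^sub>R \<xi>)
      = - g x (br \<xi> (\<phi> (- \<phi> y) + \<eta> y *\<^sub>R \<xi>))"
    by (simp only: on_image bilinear_radd[OF bilinear_g] bilinear_rmul[OF bilinear_g]
        bilinear_radd[OF bilinear_br] bilinear_rmul[OF bilinear_br])
      (simp add: bilinear_rzero[OF bilinear_g])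
  then show ?thesis by (simp only: y[symmetric])
qed

text \<open>
  Pairing with \<open>x\<close> moves \<open>ad H\<close> off \<open>\<xi>\<close> and turns the left-hand side into \<open>\<eta>([H, x])\<close>, which
  the contact condition \<open>d\<eta> = 2\<Phi>\<close> evaluates.
\<close>

lemma bracket_reeb_of_symmetric_ad:
  assumes "\<And>x y. g (br H x) y = g x (br H y)"
  shows "br H \<xi> = 2 *\<^sub>R \<phi> H"
proof -
  have "g (br H \<xi> - 2 *\<^sub>R \<phi> H) x = 0" for x
  proof -
    have "g (br H \<xi>) x = \<eta> (br H x)" using assms by (simp add: eta_eq)
    also have "\<dots> = 2 * g (\<phi> H) x" by (simp add: eta_bracket phi_skew)
    finally show ?thesis
      by (simp add: bilinear_lsub[OF bilinear_g] bilinear_lmul[OF bilinear_g])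
  qed
  then show ?thesis using g_nondegenerate by (metis eq_iff_diff_eq_0)
qed

lemma phi_eq_0_imp_multiple_xi:
  assumes "\<phi> x = 0"
  shows "x = \<eta> x *\<^sub>R \<xi>"
proof -
  have "- x + \<eta> x *\<^sub>R \<xi> = 0"
    by (simp only: phi_phi[symmetric] assms linear_0[OF linear_phi])
  then show ?thesis by (metis add_eq_0_iff2 neg_equal_iff_equal)
qed

text \<open>
  Otherwise \<open>\<Phi> = d\<eta> / 2\<close> would vanish, hence also \<open>\<phi>\<close> by nondegeneracy of \<open>g\<close>, and \<open>\<xi>\<close> would
  span the whole algebra.
\<close>

lemma reeb_not_orthogonal_to_brackets:
  assumes "n \<ge> 1"
  shows "\<exists>x y. g \<xi> (br x y) \<noteq> 0"
proof (rule ccontr)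
  assume "\<not> ?thesis"
  then have "g x (\<phi> y) = 0" for x y
    using eta_bracket[of x y] eta_eq by simp
  then have "\<phi> y = 0" for y
    using g_nondegenerate[of "\<phi> y"] g_sym by metis
  then have "x \<in> span {\<xi>}" for x
    using phi_eq_0_imp_multiple_xi[of x] by (metis span_base span_mul singletonI)
  then have "dim (UNIV :: 'a set) \<le> card {\<xi>}"
    by (intro dim_le_card) auto
  then show False using dim_eq assms by simp
qed

text \<open>
  \<open>ad \<xi>\<close> kills \<open>H\<close> because, being skew-symmetric, its kernel is the orthogonal of its image, and
  \<open>H\<close> is orthogonal to all brackets. Symmetry of \<open>ad H\<close> identifies \<open>[H, \<xi>]\<close> with \<open>2 \<phi> H\<close>, so
  \<open>H\<close> lies in the kernel of \<open>\<phi>\<close>, which is the line through \<open>\<xi>\<close>.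
\<close>

lemma iwasawa_complement_subset_reeb_line:
  assumes iw: "pseudo_iwasawa br g \<gg> \<aa>" and H: "H \<in> \<aa>"
  shows "H = \<eta> H *\<^sub>R \<xi>"
proof -
  have std: "standard_decomposition br g \<gg> \<aa>" and sym: "\<And>x y. g (br H x) y = g x (br H y)"
    using iw H by (auto simp: pseudo_iwasawa_def)
  have orth: "g H (br x y) = 0" for x y
    using standard_decomposition_bracket_orthogonal[OF lie std H] g_sym[of H] by simp
  have "br \<xi> H = 0"
    using orth g_nondegenerate[of "br \<xi> H"] by (simp add: reeb_killing)
  then have "\<phi> H = 0"
    using bracket_reeb_of_symmetric_ad[OF sym] lie_bracket_skew[OF lie, of H \<xi>] by simp
  then show ?thesis by (rule phi_eq_0_imp_multiple_xi)
qed

end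

theorem proposition2p6:
  fixes br :: "'a::real_vector \<Rightarrow> 'a \<Rightarrow> 'a"
    and \<phi> :: "'a \<Rightarrow> 'a" and \<xi> :: 'a and \<eta> :: "'a \<Rightarrow> real"
    and g :: "'a \<Rightarrow> 'a \<Rightarrow> real" and n :: nat
  assumes "lie_algebra br"
    and "lie_solvable br UNIV"
    and "n \<ge> 1"
    and "sasaki n br \<phi> \<xi> \<eta> g"
  shows "\<not> (\<exists>\<gg> \<aa>. pseudo_iwasawa br g \<gg> \<aa> \<and> \<aa> \<noteq> {0})"
proof
  interpret sasaki_lie_algebra br \<phi> \<xi> \<eta> g n
    using assms by unfold_locales
  assume "\<exists>\<gg> \<aa>. pseudo_iwasawa br g \<gg> \<aa> \<and> \<aa> \<noteq> {0}"
  then obtain \<gg> \<aa> where iw: "pseudo_iwasawa br g \<gg> \<aa>" and ne: "\<aa> \<noteq> {0}" by blast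
  have std: "standard_decomposition br g \<gg> \<aa>" using iw by (simp add: pseudo_iwasawa_def)
  have sub: "subspace \<aa>" using std by (simp add: standard_decomposition_def lie_subalgebra_def)
  obtain H where H: "H \<in> \<aa>" "H \<noteq> 0"
    using ne subspace_0[OF sub] by blast
  have line: "H = \<eta> H *\<^sub>R \<xi>" by (rule iwasawa_complement_subset_reeb_line[OF iw H(1)])
  with H(2) have "\<eta> H \<noteq> 0" by (metis scaleR_zero_left)
  then have "\<xi> = inverse (\<eta> H) *\<^sub>R (\<eta> H *\<^sub>R \<xi>)" by simp
  then have "\<xi> = inverse (\<eta> H) *\<^sub>R H" using line by metis
  then have "\<xi> \<in> \<aa>" using subspace_scale[OF sub H(1)] by metis
  then have "g \<xi> (br x y) = 0" for x y
    using standard_decomposition_bracket_orthogonal[OF assms(1) std] g_sym[of \<xi>] by simp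
  then show False
    using reeb_not_orthogonal_to_brackets[OF assms(3)] by blast
qed

end
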